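(* Let $S$ be a random variable satisfying $\mathsf{supp}\,S\subseteq[0,1]$ and $\mathbb{E}[S]\le\mathbf{h}^{\mathsf T}\boldsymbol{\alpha}$. Then the following claims are equivalent: (1) there exists a vector $\mathbf{a}$ satisfying $\mathbf{0}\preccurlyeq\mathbf{a}\preccurlyeq\boldsymbol{\alpha}$ such that $S$ is $(\mathbf{h},\mathbf{a})$-decomposable; (2) for each $k\in\{1,\dots,n-1\}$, $\pi_S(\mathsf{H}_{[k]})\le(1-\mathsf{H}_{[k]})\bar\alpha_k$; (3) $S$ is $(\mathbf{h},\mathbf{a}^{\dagger})$-decomposable, where $\mathbf{a}^{\dagger}=\min\{\beta\mathbf{1},\boldsymbol{\alpha}\}$ with some $\beta\in[0,\alpha_1]$ such that $\mathbf{h}^{\mathsf T}\mathbf{a}^{\dagger}=\mathbb{E}[S]$.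
   Context: Let $n\ge 2$ be an integer, $\mathbf{h}=(h_1,\dots,h_n)^{\mathsf T}$ with $h_k>0$ and $\sum_{k=1}^n h_k=1$, and $\boldsymbol{\alpha}=(\alpha_1,\dots,\alpha_n)^{\mathsf T}$ with $1\ge\alpha_1>\alpha_2>\cdots>\alpha_n>0$ and $\alpha_n\le \tfrac12$. Put $\mathsf{H}_{[0]}=0$, $\mathsf{H}_{[k]}=\sum_{i=1}^k h_i$, and $\bar\alpha_k=\frac{\sum_{i=k+1}^n h_i\alpha_i}{1-\mathsf{H}_{[k]}}$ for $0\le k\le n-1$. $\mathsf{supp}\,X\subseteq A$ means $X\in A$ almost surely. For a random variable $S$ with $\mathsf{supp}\,S\subseteq[0,1]$ and cumulative distribution function $F_S$, the stop-loss transform is $\pi_S(t)=\int_t^1(1-F_S(x))\,dx=\mathbb{E}[(S-t)_+]$, $t\in[0,1]$, where $(a)_+=\max\{a,0\}$. For a vector $\mathbf{a}\in[0,1]^n$, $S$ is $(\mathbf{h},\mathbf{a})$-decomposable if there is a random vector $\mathbf{W}$ with $\mathsf{supp}\,\mathbf{W}\subseteq[0,1]^n$, $\mathbb{E}[\mathbf{W}]=\mathbf{a}$ and $S=\mathbf{h}^{\mathsf T}\mathbf{W}$. $\mathbf{a}\preccurlyeq\mathbf{b}$ is the entrywise inequality, $\mathbf{1}$ is the all-one vector in $\mathbb{R}^n$, and $\min$ of two vectors is taken entrywise. *)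

theory Defs
  imports "HOL-Probability.Probability"
begin

text \<open>
  Vectors in \<open>\<real>\<^sup>n\<close> are functions \<open>nat \<Rightarrow> real\<close> of which only the values on \<open>{1..n}\<close> matter.
\<close>

definition dotp :: "nat \<Rightarrow> (nat \<Rightarrow> real) \<Rightarrow> (nat \<Rightarrow> real) \<Rightarrow> real" where
  "dotp n u v = (\<Sum>k=1..n. u k * v k)"

definition Hsum :: "(nat \<Rightarrow> real) \<Rightarrow> nat \<Rightarrow> real" where
  "Hsum h k = (\<Sum>i=1..k. h i)"

definition tail_avg :: "nat \<Rightarrow> (nat \<Rightarrow> real) \<Rightarrow> (nat \<Rightarrow> real) \<Rightarrow> nat \<Rightarrow> real" where
  "tail_avg n h \<alpha> k = (\<Sum>i=k+1..n. h i * \<alpha> i) / (1 - Hsum h k)"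

text \<open>
  The stop-loss transform, for random variables with values in \<open>[0,1]\<close> and \<open>t \<in> [0,1]\<close>.
\<close>

definition stop_loss :: "'a measure \<Rightarrow> ('a \<Rightarrow> real) \<Rightarrow> real \<Rightarrow> real" where
  "stop_loss M S t = (LINT x:{t..1}|lborel. 1 - cdf (distr M borel S) x)"

text \<open>
  The random vector \<open>W\<close> lives on the same probability space as \<open>S\<close>; as usual for random
  variables, \<open>S = h\<^sup>T W\<close> is almost sure equality.  Membership of \<open>a\<close> in \<open>[0,1]\<^sup>n\<close> follows
  from the condition on the means.
\<close>

definition decomposable ::
  "'a measure \<Rightarrow> nat \<Rightarrow> (nat \<Rightarrow> real) \<Rightarrow> (nat \<Rightarrow> real) \<Rightarrow> ('a \<Rightarrow> real) \<Rightarrow> bool" where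
  "decomposable M n h a S \<longleftrightarrow>
    (\<exists>W \<in> M \<rightarrow>\<^sub>M (\<Pi>\<^sub>M k\<in>{1..n}. (borel :: real measure)).
      (AE \<omega> in M. W \<omega> \<in> (\<Pi>\<^sub>E k\<in>{1..n}. {0..1})) \<and>
      (\<forall>k\<in>{1..n}. integral\<^sup>L M (\<lambda>\<omega>. W \<omega> k) = a k) \<and>
      (AE \<omega> in M. S \<omega> = dotp n h (W \<omega>)))"

end

theory Submission
  imports Defs
begin

text \<open>
  The greedy decomposition, which fills the coordinates in the order \<open>1, 2, \<dots>, n\<close>, has the
  prefix sums \<open>E min(S, H_k)\<close>, the largest possible ones.  The set of decomposing mean vectors
  is closed under \<open>h\<close>-weighted transfers from a larger to a smaller entry, so by the argument
  of Hardy, Littlewood and Polya it contains every decreasing vector with the same total and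
  smaller prefix sums.  For \<open>min \<beta> \<alpha>\<close> the prefix inequality at \<open>k\<close> is condition (2) if
  \<open>\<alpha> (k + 1) \<le> \<beta>\<close>, and otherwise follows from the one at \<open>k + 1\<close>, since \<open>min(S, t) / t\<close> decreases in \<open>t\<close>.
\<close>

section \<open>Coordinates of the random vector and the stop-loss transform\<close>

text \<open>Trades the single map into the product space for a family of real random variables,
  whose members can be replaced one at a time without returning to product measurability.\<close>

lemma decomposable_iff:
  "decomposable M n h a S \<longleftrightarrow>
    (\<exists>V. (\<forall>k\<in>{1..n}. V k \<in> borel_measurable M) \<and>
      (AE \<omega> in M. \<forall>k\<in>{1..n}. V k \<omega> \<in> {0..1}) \<and>
      (\<forall>k\<in>{1..n}. integral\<^sup>L M (V k) = a k) \<and>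
      (AE \<omega> in M. S \<omega> = (\<Sum>k=1..n. h k * V k \<omega>)))" (is "?L = ?R")
proof
  assume ?L
  then obtain W where W: "W \<in> M \<rightarrow>\<^sub>M (\<Pi>\<^sub>M k\<in>{1..n}. (borel :: real measure))"
    "AE \<omega> in M. W \<omega> \<in> (\<Pi>\<^sub>E k\<in>{1..n}. {0..1})"
    "\<forall>k\<in>{1..n}. integral\<^sup>L M (\<lambda>\<omega>. W \<omega> k) = a k"
    "AE \<omega> in M. S \<omega> = dotp n h (W \<omega>)"
    unfolding decomposable_def by blast
  have "\<forall>k\<in>{1..n}. (\<lambda>\<omega>. W \<omega> k) \<in> borel_measurable M"
    using measurable_compose[OF W(1) measurable_component_singleton] by blast
  moreover have "AE \<omega> in M. \<forall>k\<in>{1..n}. W \<omega> k \<in> {0..1}"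
    using W(2) by eventually_elim (auto simp: PiE_iff)
  moreover have "AE \<omega> in M. S \<omega> = (\<Sum>k=1..n. h k * W \<omega> k)"
    using W(4) unfolding dotp_def .
  ultimately show ?R using W(3) by (intro exI[of _ "\<lambda>k \<omega>. W \<omega> k"]) simp
next
  assume ?R
  then obtain V where V: "\<forall>k\<in>{1..n}. V k \<in> borel_measurable M"
    "AE \<omega> in M. \<forall>k\<in>{1..n}. V k \<omega> \<in> {0..1}"
    "\<forall>k\<in>{1..n}. integral\<^sup>L M (V k) = a k"
    "AE \<omega> in M. S \<omega> = (\<Sum>k=1..n. h k * V k \<omega>)" by blast
  \<comment> \<open>Points of the product space are extensional functions, hence the restriction to
    \<open>{1..n}\<close>.\<close>
  define W where "W \<omega> = (\<lambda>k\<in>{1..n}. V k \<omega>)" for \<omega>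
  have "W \<in> M \<rightarrow>\<^sub>M (\<Pi>\<^sub>M k\<in>{1..n}. borel)"
    unfolding W_def using V(1) by (intro measurable_restrict) blast
  moreover have "AE \<omega> in M. W \<omega> \<in> (\<Pi>\<^sub>E k\<in>{1..n}. {0..1})"
    using V(2) by eventually_elim (auto simp: W_def)
  moreover have "\<forall>k\<in>{1..n}. integral\<^sup>L M (\<lambda>\<omega>. W \<omega> k) = a k"
    using V(3) by (simp add: W_def)
  moreover have "AE \<omega> in M. S \<omega> = dotp n h (W \<omega>)"
    using V(4) by eventually_elim (simp add: dotp_def W_def)
  ultimately show ?L unfolding decomposable_def by blast
qed

lemma (in prob_space) integrable_unit_interval:
  fixes X :: "'a \<Rightarrow> real"
  assumes "X \<in> borel_measurable M" "AE \<omega> in M. X \<omega> \<in> {0..1}"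
  shows "integrable M X"
  using assms by (intro integrable_const_bound[of _ 1]) (auto elim: eventually_mono)

text \<open>Layer-cake argument: \<open>max (s - t) 0\<close> is the length of the set of
  \<open>x\<close> with \<open>t \<le> x < s\<close>, and Fubini exchanges this length with the
  expectation.\<close>

lemma (in prob_space) stop_loss_eq_expectation:
  fixes S :: "'a \<Rightarrow> real"
  assumes [measurable]: "S \<in> borel_measurable M"
    and S01: "AE \<omega> in M. S \<omega> \<in> {0..1}"
  shows "stop_loss M S t = expectation (\<lambda>\<omega>. max (S \<omega> - t) 0)"
proof -
  interpret pair_sigma_finite M lborel ..
  \<comment> \<open>The two iterated integrals of this indicator are the two sides of the claim. It
    is dominated by the indicator of the strip \<open>space M \<times> {t..1}\<close>, which has
    finite measure because \<open>M\<close> is a probability space.\<close>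
  let ?f = "\<lambda>(\<omega>, x). indicator {t..1} x * indicator {x<..} (S \<omega>) :: real"
  have "integrable (M \<Otimes>\<^sub>M lborel) (\<lambda>(\<omega>, x). indicator {t..1} x :: real)"
  proof -
    have "integrable (M \<Otimes>\<^sub>M lborel) (indicat_real (space M \<times> {t..1}))"
      by (subst integrable_indicator_iff) (auto simp: lborel.emeasure_pair_measure_Times emeasure_space_1 emeasure_lborel_Icc_eq)
    then show ?thesis
      by (rule Bochner_Integration.integrable_cong[THEN iffD1, rotated 2]) (auto simp: space_pair_measure indicator_def)
  qed
  moreover have meas: "?f \<in> borel_measurable (M \<Otimes>\<^sub>M lborel)"
    unfolding indicator_def greaterThan_iff by measurable
  ultimately have int: "integrable (M \<Otimes>\<^sub>M lborel) ?f"
    by (rule Bochner_Integration.integrable_bound) (auto split: split_indicator)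
  have "1 - cdf (distr M borel S) x = expectation (\<lambda>\<omega>. indicator {x<..} (S \<omega>))" for x
  proof -
    have "1 - cdf (distr M borel S) x = 1 - prob (S -` {..x} \<inter> space M)"
      by (simp add: cdf_def measure_distr)
    also have "\<dots> = prob (space M - (S -` {..x} \<inter> space M))"
      by (subst prob_compl) auto
    also have "space M - (S -` {..x} \<inter> space M) = S -` {x<..} \<inter> space M"
      by auto
    also have "prob \<dots> = expectation (indicat_real (S -` {x<..} \<inter> space M))"
      by simp
    also have "\<dots> = expectation (\<lambda>\<omega>. indicator {x<..} (S \<omega>))"
      by (intro Bochner_Integration.integral_cong) (auto simp: indicator_def)
    finally show ?thesis .
  qed
  then have "stop_loss M S t = (LINT x|lborel. (LINT \<omega>|M. ?f (\<omega>, x)))"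
    by (simp add: stop_loss_def set_lebesgue_integral_def)
  also have "\<dots> = (LINT \<omega>|M. (LINT x|lborel. ?f (\<omega>, x)))"
    using Fubini_integral[of "\<lambda>\<omega> x. ?f (\<omega>, x)"] int by (simp add: case_prod_unfold)
  also have "\<dots> = expectation (\<lambda>\<omega>. max (S \<omega> - t) 0)"
  proof (rule integral_cong_AE)
    show "AE \<omega> in M. (LINT x|lborel. ?f (\<omega>, x)) = max (S \<omega> - t) 0"
      using S01
    proof eventually_elim
      case (elim \<omega>)
      \<comment> \<open>The cut-off at 1 disappears because \<open>x < S \<omega>\<close> already
        forces \<open>x < 1\<close>.\<close>
      have "(LINT x|lborel. ?f (\<omega>, x)) = (LINT x|lborel. indicator {t..<S \<omega>} x)"
        using elim by (intro Bochner_Integration.integral_cong) (auto simp: indicator_def)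
      also have "\<dots> = max (S \<omega> - t) 0"
        by (cases "t \<le> S \<omega>") simp_all
      finally show ?case .
    qed
    show "(\<lambda>\<omega>. LINT x|lborel. ?f (\<omega>, x)) \<in> borel_measurable M"
      using lborel.borel_measurable_lebesgue_integral[of "\<lambda>\<omega> x. ?f (\<omega>, x)" M] meas
      by (simp add: case_prod_unfold)
  qed measurable
  finally show ?thesis .
qed

section \<open>Weighted transfers and majorization\<close>

text \<open>Coordinates \<open>i\<close> and \<open>j\<close> are replaced by convex combinations of
  each other, with mixing weights \<open>t * h j\<close> and \<open>t * h i\<close>; both weights
  lie in [0,1], so the values stay there. Coordinate \<open>i\<close> loses exactly the weighted
  amount \<open>t * h i * h j * (V i - V j)\<close> that \<open>j\<close> gains, so the weighted sum
  remains \<open>S\<close>.\<close>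

lemma (in prob_space) decomposable_transfer:
  fixes h a :: "nat \<Rightarrow> real"
  assumes dec: "decomposable M n h a S"
    and ij: "i \<in> {1..n}" "j \<in> {1..n}" "i \<noteq> j"
    and h: "h i > 0" "h j > 0"
    and t: "0 \<le> t" "t * h i \<le> 1" "t * h j \<le> 1"
  shows "decomposable M n h
    (a(i := a i - t * h j * (a i - a j), j := a j + t * h i * (a i - a j))) S"
proof -
  obtain V where V: "\<forall>k\<in>{1..n}. V k \<in> borel_measurable M"
    "AE \<omega> in M. \<forall>k\<in>{1..n}. V k \<omega> \<in> {0..1}"
    "\<forall>k\<in>{1..n}. integral\<^sup>L M (V k) = a k"
    "AE \<omega> in M. S \<omega> = (\<Sum>k=1..n. h k * V k \<omega>)"
    using dec unfolding decomposable_iff by blast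
  define U where "U = V(i := \<lambda>\<omega>. V i \<omega> - t * h j * (V i \<omega> - V j \<omega>),
                        j := \<lambda>\<omega>. V j \<omega> + t * h i * (V i \<omega> - V j \<omega>))"
  have int: "integrable M (V k)" if "k \<in> {1..n}" for k
    using V(1,2) that by (intro integrable_unit_interval) (auto elim: eventually_mono)
  have mix: "(1 - s) * x + s * y \<in> {0..1}"
    if "0 \<le> s" "s \<le> 1" "x \<in> {0..1}" "y \<in> {0..1}" for s x y :: real
    using that convex_bound_le[of x 1 y "1 - s" s] by auto
  have U01: "AE \<omega> in M. \<forall>k\<in>{1..n}. U k \<omega> \<in> {0..1}"
    using V(2)
  proof eventually_elim
    case (elim \<omega>)
    have "(1 - t * h j) * V i \<omega> + (t * h j) * V j \<omega> \<in> {0..1}"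
      "(1 - t * h i) * V j \<omega> + (t * h i) * V i \<omega> \<in> {0..1}"
      using elim ij h t by (intro mix; simp)+
    moreover have "(1 - t * h j) * V i \<omega> + (t * h j) * V j \<omega> = U i \<omega>"
      "(1 - t * h i) * V j \<omega> + (t * h i) * V i \<omega> = U j \<omega>"
      using ij(3) by (simp_all add: U_def algebra_simps)
    ultimately have "U i \<omega> \<in> {0..1}" "U j \<omega> \<in> {0..1}" by simp_all
    moreover have "U k \<omega> \<in> {0..1}" if "k \<in> {1..n}" "k \<noteq> i" "k \<noteq> j" for k
      using elim that by (simp add: U_def)
    ultimately show ?case by blast
  qed
  have sum: "(\<Sum>k=1..n. h k * U k \<omega>) = (\<Sum>k=1..n. h k * V k \<omega>)" for \<omega>
  proof -
    have split: "(\<Sum>k=1..n. g k) = g i + (g j + (\<Sum>k\<in>{1..n} - {i} - {j}. g k))"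
      for g :: "nat \<Rightarrow> real"
      using ij by (simp add: sum.remove[of _ i] sum.remove[of _ j])
    have "(\<Sum>k\<in>{1..n} - {i} - {j}. h k * U k \<omega>) = (\<Sum>k\<in>{1..n} - {i} - {j}. h k * V k \<omega>)"
      by (intro sum.cong) (auto simp: U_def)
    then show ?thesis
      unfolding split using ij(3) by (simp add: U_def algebra_simps)
  qed
  show ?thesis
    unfolding decomposable_iff
  proof (intro exI[of _ U] conjI U01)
    have [measurable]: "V i \<in> borel_measurable M" "V j \<in> borel_measurable M"
      using V(1) ij by auto
    have "U i \<in> borel_measurable M" "U j \<in> borel_measurable M"
      unfolding U_def using ij(3) by simp_all
    moreover have "U k \<in> borel_measurable M" if "k \<in> {1..n}" "k \<noteq> i" "k \<noteq> j" for k
      using V(1) that by (simp add: U_def)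
    ultimately show "\<forall>k\<in>{1..n}. U k \<in> borel_measurable M"
      by blast
    show "\<forall>k\<in>{1..n}. integral\<^sup>L M (U k)
      = (a(i := a i - t * h j * (a i - a j), j := a j + t * h i * (a i - a j))) k"
      using V(3) int ij by (auto simp: U_def)
    show "AE \<omega> in M. S \<omega> = (\<Sum>k=1..n. h k * U k \<omega>)"
      using V(4) by (simp only: sum)
  qed
qed

lemma decomposable_cong:
  assumes "\<And>k. k \<in> {1..n} \<Longrightarrow> a k = b k"
  shows "decomposable M n h a S \<longleftrightarrow> decomposable M n h b S"
  using assms unfolding decomposable_def by simp

text \<open>Induction on the number of entries where \<open>a\<close> and \<open>b\<close> differ.
  At the first \<open>j\<close> with \<open>b j < a j\<close>, the prefix inequality yields an
  \<open>i < j\<close> with \<open>a i < b i\<close>. As \<open>a\<close> decreases,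
  \<open>b j < a j \<le> a i < b i\<close>, so a transfer from \<open>i\<close> to \<open>j\<close>
  is possible. Moved as far as \<open>a\<close> allows, it makes one of the two entries agree and
  preserves the prefix inequalities.\<close>

lemma (in prob_space) decomposable_majorized:
  fixes h a b :: "nat \<Rightarrow> real"
  assumes h: "\<And>k. k \<in> {1..n} \<Longrightarrow> h k > 0"
    and anti: "\<And>i j. 1 \<le> i \<Longrightarrow> i < j \<Longrightarrow> j \<le> n \<Longrightarrow> a j \<le> a i"
    and "decomposable M n h b S"
    and "\<And>k. k \<in> {1..n} \<Longrightarrow> (\<Sum>i=1..k. h i * a i) \<le> (\<Sum>i=1..k. h i * b i)"
    and "(\<Sum>i=1..n. h i * a i) = (\<Sum>i=1..n. h i * b i)"
  shows "decomposable M n h a S"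
  using assms(3-)
proof (induction "card {k\<in>{1..n}. a k \<noteq> b k}" arbitrary: b rule: less_induct)
  case less
  show ?case
  proof (cases "\<exists>k\<in>{1..n}. b k < a k")
    \<comment> \<open>With \<open>a \<le> b\<close> entrywise, equal weighted totals and positive
      weights force \<open>a = b\<close> on \<open>{1..n}\<close>.\<close>
    case False
    have "(\<Sum>i=1..n. h i * (b i - a i)) = 0"
      using less.prems(3) by (simp add: algebra_simps sum_subtractf)
    moreover have "h i * (b i - a i) \<ge> 0" if "i \<in> {1..n}" for i
      using that False h[OF that] by (intro mult_nonneg_nonneg) (auto simp: not_less)
    ultimately have "\<forall>i\<in>{1..n}. h i * (b i - a i) = 0"
      by (subst (asm) sum_nonneg_eq_0_iff) auto
    then have "a i = b i" if "i \<in> {1..n}" for i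
      using h[OF that] that by force
    with less.prems(1) show ?thesis
      using decomposable_cong[of n a b] by blast
  next
    case True
    define j where "j = (LEAST k. k \<in> {1..n} \<and> b k < a k)"
    have j: "j \<in> {1..n}" "b j < a j"
      using LeastI_ex[of "\<lambda>k. k \<in> {1..n} \<and> b k < a k"] True unfolding j_def by blast+
    have before: "a k \<le> b k" if "1 \<le> k" "k < j" for k
      using not_less_Least[of k "\<lambda>k. k \<in> {1..n} \<and> b k < a k"] that j
      unfolding j_def[symmetric] by auto
    \<comment> \<open>Otherwise \<open>a\<close> and \<open>b\<close> agree before \<open>j\<close>,
      and \<open>b j < a j\<close> breaks the prefix inequality at \<open>j\<close>.\<close>
    have "\<exists>i\<in>{1..<j}. a i < b i"
    proof (rule ccontr)
      assume "\<not> ?thesis"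
      then have "(\<Sum>i=1..<j. h i * a i) = (\<Sum>i=1..<j. h i * b i)"
        using before by (intro sum.cong) force+
      moreover have "(\<Sum>i=1..j. g i) = (\<Sum>i=1..<j. g i) + g j" for g :: "nat \<Rightarrow> real"
        using j(1) by (simp add: sum.last_plus)
      moreover have "h j * b j < h j * a j"
        using j h by simp
      ultimately show False
        using less.prems(2)[OF j(1)] by simp
    qed
    then obtain i where i: "1 \<le> i" "i < j" "a i < b i" by auto
    have hi: "h i > 0" and hj: "h j > 0"
      using h i j by auto
    have aij: "a j \<le> a i"
      using anti i j by simp
    \<comment> \<open>The largest weighted mass that can be moved without pushing entry
      \<open>i\<close> below \<open>a i\<close> or entry \<open>j\<close> above \<open>a j\<close>.
      The parameter \<open>t\<close> solves
      \<open>t * h i * h j * (b i - b j) = \<delta>\<close>.\<close>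
    define \<delta> where "\<delta> = min (h i * (b i - a i)) (h j * (a j - b j))"
    define t where "t = \<delta> / (h i * h j * (b i - b j))"
    define c where "c = b(i := b i - t * h j * (b i - b j), j := b j + t * h i * (b i - b j))"
    have bij: "b i - b j > 0" using i j aij by simp
    have \<delta>: "\<delta> > 0" "\<delta> \<le> h i * (b i - a i)" "\<delta> \<le> h j * (a j - b j)"
      using hi hj i j by (auto simp: \<delta>_def)
    have ci: "c i = b i - \<delta> / h i" and cj: "c j = b j + \<delta> / h j"
      using hi hj bij i(2) by (simp_all add: c_def t_def)
    have ck: "c k = b k" if "k \<noteq> i" "k \<noteq> j" for k
      using that by (simp add: c_def)
    have t_mult: "t * h j = \<delta> / (h i * (b i - b j))" "t * h i = \<delta> / (h j * (b i - b j))"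
      using hi hj by (simp_all add: t_def)
    \<comment> \<open>Since \<open>b j < a j \<le> a i\<close>, the gap \<open>b i - b j\<close>
      exceeds \<open>b i - a i\<close>; likewise it exceeds \<open>a j - b j\<close> below. Hence
      both mixing weights are at most 1.\<close>
    have "\<delta> \<le> h i * (b i - b j)"
      using \<delta>(2) hi i j aij by (smt (verit) mult_left_mono)
    then have tj: "t * h j \<le> 1"
      unfolding t_mult using hi bij by simp
    have "\<delta> \<le> h j * (b i - b j)"
      using \<delta>(3) hj i j aij by (smt (verit) mult_left_mono)
    then have ti: "t * h i \<le> 1"
      unfolding t_mult using hj bij by simp
    have t0: "0 \<le> t"
      using \<delta> hi hj bij by (simp add: t_def)
    have dec: "decomposable M n h c S"
      unfolding c_def using i j by (intro decomposable_transfer less.prems hi hj t0 ti tj) auto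
    have cai: "a i \<le> c i" and caj: "c j \<le> a j"
      using \<delta> hi hj by (simp_all add: ci cj field_simps)
    have aci: "a i = c i \<or> a j = c j"
    proof (cases "h i * (b i - a i) \<le> h j * (a j - b j)")
      case True
      then have "\<delta> = h i * (b i - a i)" by (simp add: \<delta>_def)
      then show ?thesis using hi by (simp add: ci)
    next
      case False
      then have "\<delta> = h j * (a j - b j)" by (simp add: \<delta>_def)
      then show ?thesis using hj by (simp add: cj)
    qed
    \<comment> \<open>Such a prefix contains both \<open>i\<close> and \<open>j\<close>, so the
      transfer cancels within it.\<close>
    have prefix: "(\<Sum>l=1..k. h l * c l) = (\<Sum>l=1..k. h l * b l)" if "j \<le> k" for k
    proof -
      have split: "(\<Sum>l=1..k. g l) = g i + (g j + (\<Sum>l\<in>{1..k} - {i} - {j}. g l))"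
        for g :: "nat \<Rightarrow> real"
        using i j that by (simp add: sum.remove[of _ i] sum.remove[of _ j])
      have "(\<Sum>l\<in>{1..k} - {i} - {j}. h l * c l) = (\<Sum>l\<in>{1..k} - {i} - {j}. h l * b l)"
        by (intro sum.cong) (auto simp: ck)
      moreover have "h i * c i = h i * b i - \<delta>" "h j * c j = h j * b j + \<delta>"
        using hi hj by (simp_all add: ci cj right_diff_distrib distrib_left)
      ultimately show ?thesis
        unfolding split by linarith
    qed
    show ?thesis
    proof (rule less.hyps[OF _ dec])
      \<comment> \<open>Only \<open>i\<close> and \<open>j\<close> change, and both were places of
        disagreement, so no new one arises; by \<open>aci\<close> at least one of them drops
        out.\<close>
      have "{k\<in>{1..n}. a k \<noteq> c k} \<subseteq> {k\<in>{1..n}. a k \<noteq> b k}"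
      proof safe
        fix k assume "a k \<noteq> c k" "a k = b k"
        then show False
          using i(3) j(2) ck[of k] by (cases "k = i"; cases "k = j") simp_all
      qed
      moreover have "{k\<in>{1..n}. a k \<noteq> c k} \<noteq> {k\<in>{1..n}. a k \<noteq> b k}"
      proof -
        obtain l where "l = i \<or> l = j" "a l = c l"
          using aci by blast
        then have "l \<in> {k\<in>{1..n}. a k \<noteq> b k}" "l \<notin> {k\<in>{1..n}. a k \<noteq> c k}"
          using i j by auto
        then show ?thesis by metis
      qed
      ultimately show "card {k\<in>{1..n}. a k \<noteq> c k} < card {k\<in>{1..n}. a k \<noteq> b k}"
        by (intro psubset_card_mono) auto
    next
      fix k assume k: "k \<in> {1..n}"
      show "(\<Sum>l=1..k. h l * a l) \<le> (\<Sum>l=1..k. h l * c l)"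
      proof (cases "j \<le> k")
        case True
        with prefix less.prems(2) k show ?thesis by simp
      next
        \<comment> \<open>Before \<open>j\<close> the vector \<open>b\<close> dominates
          \<open>a\<close> entrywise, and lowering entry \<open>i\<close> to at least
          \<open>a i\<close> keeps this so.\<close>
        case False
        have "a l \<le> c l" if "l \<in> {1..k}" for l
          using that False before[of l] cai ck[of l] by (cases "l = i") auto
        then show ?thesis
          using h k by (intro sum_mono mult_left_mono) (auto intro: less_imp_le)
      qed
    next
      show "(\<Sum>i=1..n. h i * a i) = (\<Sum>i=1..n. h i * c i)"
        using prefix[of n] j less.prems(3) by simp
    qed
  qed
qed

section \<open>The greedy decomposition\<close>

text \<open>Coordinate \<open>k\<close> is the fraction of the interval from
  \<open>Hsum h (k - 1)\<close> to \<open>Hsum h k\<close> that lies below \<open>S\<close>. The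
  weighted coordinates telescope to \<open>min S (Hsum h k)\<close>, and to \<open>S\<close> itself
  at \<open>k = n\<close>, where \<open>Hsum h n = 1\<close>.\<close>

lemma (in prob_space) decomposable_greedy:
  fixes h :: "nat \<Rightarrow> real" and S :: "'a \<Rightarrow> real"
  assumes h: "\<And>k. k \<in> {1..n} \<Longrightarrow> h k > 0" "(\<Sum>k=1..n. h k) = 1"
    and S [measurable]: "S \<in> borel_measurable M" "AE \<omega> in M. S \<omega> \<in> {0..1}"
  obtains b where "decomposable M n h b S"
    "\<And>k. k \<le> n \<Longrightarrow> (\<Sum>i=1..k. h i * b i) = expectation (\<lambda>\<omega>. min (S \<omega>) (Hsum h k))"
proof -
  define T where "T k \<omega> = min (S \<omega>) (Hsum h k)" for k \<omega>
  define V where "V k \<omega> = (T k \<omega> - T (k - 1) \<omega>) / h k" for k \<omega>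
  have H: "Hsum h k = Hsum h (k - 1) + h k" if "k \<ge> 1" for k
    using that by (cases k) (simp_all add: Hsum_def)
  have [measurable]: "T k \<in> borel_measurable M" for k
    unfolding T_def by measurable
  have intS: "integrable M S"
    using S by (rule integrable_unit_interval)
  have intT: "integrable M (T k)" for k
    unfolding T_def using intS by (intro integrable_min) auto
  \<comment> \<open>The term \<open>T 0 \<omega> = min (S \<omega>) 0\<close> is kept because it
    vanishes only almost surely.\<close>
  have tel: "(\<Sum>i=1..k. h i * V i \<omega>) = T k \<omega> - T 0 \<omega>" if "k \<le> n" for k \<omega>
    using that
  proof (induction k)
    case (Suc k)
    then show ?case using h(1)[of "Suc k"] by (simp add: V_def)
  qed simp
  have T0: "AE \<omega> in M. T 0 \<omega> = 0"
    using S(2) by eventually_elim (simp add: T_def Hsum_def)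
  then have ET0: "expectation (T 0) = 0"
    using integral_cong_AE[of "T 0" M "\<lambda>_. 0"] by simp
  have "decomposable M n h (\<lambda>k. expectation (V k)) S"
    unfolding decomposable_iff
  proof (intro exI[of _ V] conjI)
    show "\<forall>k\<in>{1..n}. V k \<in> borel_measurable M"
      unfolding V_def by measurable
    \<comment> \<open>Holds at every point, since \<open>c \<mapsto> min s c\<close> is increasing
      and 1-Lipschitz.\<close>
    have "V k \<omega> \<in> {0..1}" if "k \<in> {1..n}" for k \<omega>
      using that h(1)[OF that] H[of k] by (auto simp: V_def T_def field_simps min_def)
    then show "AE \<omega> in M. \<forall>k\<in>{1..n}. V k \<omega> \<in> {0..1}" by simp
    show "AE \<omega> in M. S \<omega> = (\<Sum>k=1..n. h k * V k \<omega>)"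
      using T0 S(2)
    proof eventually_elim
      case (elim \<omega>)
      then show ?case using tel[of n \<omega>] h(2) by (simp add: T_def Hsum_def)
    qed
  qed simp
  moreover have "(\<Sum>i=1..k. h i * expectation (V i)) = expectation (\<lambda>\<omega>. min (S \<omega>) (Hsum h k))"
    if "k \<le> n" for k
  proof -
    have intV: "integrable M (V i)" for i
      unfolding V_def using intT by simp
    have "(\<Sum>i=1..k. h i * expectation (V i)) = expectation (\<lambda>\<omega>. \<Sum>i=1..k. h i * V i \<omega>)"
      using intV by (subst Bochner_Integration.integral_sum) auto
    also have "\<dots> = expectation (T k)"
      unfolding tel[OF that] using intT ET0 by simp
    finally show ?thesis by (simp add: T_def[abs_def])
  qed
  ultimately show thesis by (rule that)
qed

section \<open>Stop-loss bounds against decomposability\<close>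

text \<open>The first \<open>k\<close> coordinates contribute at most \<open>Hsum h k\<close> to
  \<open>S\<close>, so the excess of \<open>S\<close> over it is covered by the nonnegative
  remaining terms; the bound follows by taking expectations.\<close>

lemma (in prob_space) stop_loss_le_of_decomposable:
  fixes h a :: "nat \<Rightarrow> real"
  assumes h: "\<And>k. k \<in> {1..n} \<Longrightarrow> h k > 0"
    and S [measurable]: "S \<in> borel_measurable M" "AE \<omega> in M. S \<omega> \<in> {0..1}"
    and dec: "decomposable M n h a S" and k: "k \<le> n"
  shows "stop_loss M S (Hsum h k) \<le> (\<Sum>i=k+1..n. h i * a i)"
proof -
  obtain V where V: "\<forall>k\<in>{1..n}. V k \<in> borel_measurable M"
    "AE \<omega> in M. \<forall>k\<in>{1..n}. V k \<omega> \<in> {0..1}"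
    "\<forall>k\<in>{1..n}. integral\<^sup>L M (V k) = a k"
    "AE \<omega> in M. S \<omega> = (\<Sum>k=1..n. h k * V k \<omega>)"
    using dec unfolding decomposable_iff by blast
  have int: "integrable M (V k)" if "k \<in> {1..n}" for k
    using V(1,2) that by (intro integrable_unit_interval) (auto elim: eventually_mono)
  have "stop_loss M S (Hsum h k) = expectation (\<lambda>\<omega>. max (S \<omega> - Hsum h k) 0)"
    using S by (rule stop_loss_eq_expectation)
  also have "\<dots> \<le> expectation (\<lambda>\<omega>. \<Sum>i=k+1..n. h i * V i \<omega>)"
  proof (rule integral_mono_AE)
    show "integrable M (\<lambda>\<omega>. max (S \<omega> - Hsum h k) 0)"
      using integrable_unit_interval[OF S] by (intro integrable_max) auto
    show "integrable M (\<lambda>\<omega>. \<Sum>i=k+1..n. h i * V i \<omega>)"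
      using int by auto
    show "AE \<omega> in M. max (S \<omega> - Hsum h k) 0 \<le> (\<Sum>i=k+1..n. h i * V i \<omega>)"
      using V(2,4)
    proof eventually_elim
      case (elim \<omega>)
      have "(\<Sum>i=1..k. h i * V i \<omega>) \<le> (\<Sum>i=1..k. h i * 1)"
        using elim h k by (intro sum_mono mult_left_mono) (auto intro: less_imp_le)
      moreover have "(\<Sum>i=1..n. h i * V i \<omega>) = (\<Sum>i=1..k. h i * V i \<omega>) + (\<Sum>i=k+1..n. h i * V i \<omega>)"
        using k sum.ub_add_nat[of 1 k "\<lambda>i. h i * V i \<omega>" "n - k"] by simp
      moreover have "0 \<le> (\<Sum>i=k+1..n. h i * V i \<omega>)"
        using elim h by (intro sum_nonneg mult_nonneg_nonneg) (auto intro: less_imp_le)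
      ultimately show ?case
        using elim by (simp add: Hsum_def)
    qed
  qed
  also have "\<dots> = (\<Sum>i=k+1..n. h i * a i)"
    using V(3) int by (subst Bochner_Integration.integral_sum) auto
  finally show ?thesis .
qed

text \<open>The capped vector is compared with the greedy mean vector by
  \<open>decomposable_majorized\<close>. Its prefix inequalities come from a downward induction
  starting at \<open>k = n\<close>, where equality holds by the choice of
  \<open>\<beta>\<close>.\<close>

lemma (in prob_space) decomposable_min_of_stop_loss_le:
  fixes h \<alpha> :: "nat \<Rightarrow> real"
  assumes h: "\<And>k. k \<in> {1..n} \<Longrightarrow> h k > 0" "(\<Sum>k=1..n. h k) = 1"
    and anti: "\<And>i j. 1 \<le> i \<Longrightarrow> i \<le> j \<Longrightarrow> j \<le> n \<Longrightarrow> \<alpha> j \<le> \<alpha> i"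
    and S [measurable]: "S \<in> borel_measurable M" "AE \<omega> in M. S \<omega> \<in> {0..1}"
    and sl: "\<And>k. k \<in> {1..<n} \<Longrightarrow> stop_loss M S (Hsum h k) \<le> (\<Sum>i=k+1..n. h i * \<alpha> i)"
    and \<beta>: "(\<Sum>i=1..n. h i * min \<beta> (\<alpha> i)) = expectation S"
  shows "decomposable M n h (\<lambda>k. min \<beta> (\<alpha> k)) S"
proof -
  let ?a = "\<lambda>k. min \<beta> (\<alpha> k)" and ?\<phi> = "\<lambda>k. expectation (\<lambda>\<omega>. min (S \<omega>) (Hsum h k))"
  have intS: "integrable M S"
    using S by (rule integrable_unit_interval)
  have intT: "integrable M (\<lambda>\<omega>. min (S \<omega>) c)" for c
    using intS by (intro integrable_min) auto
  have total: "(\<Sum>i=1..n. h i * ?a i) = ?\<phi> n"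
    unfolding \<beta> using S(2) h(2)
    by (intro integral_cong_AE) (auto simp: Hsum_def elim: eventually_mono)
  have prefix: "(\<Sum>i=1..k. h i * ?a i) \<le> ?\<phi> k" if "k \<in> {1..n}" for k
  proof -
    have "k \<le> n" "1 \<le> k" using that by auto
    then show ?thesis
    proof (induction k rule: inc_induct)
      case base
      show ?case using total by simp
    next
      case (step k)
      have kn: "k \<in> {1..<n}" using step by simp
      show ?case
      proof (cases "\<alpha> (k + 1) \<le> \<beta>")
        \<comment> \<open>The cap is inactive after \<open>k\<close>, so the prefix sum is the mean
          of \<open>S\<close> minus a tail of \<open>\<alpha>\<close>. The stop-loss bound finishes,
          since \<open>s - max (s - t) 0 = min s t\<close>.\<close>
        case True
        have tail: "(\<Sum>i=k+1..n. h i * ?a i) = (\<Sum>i=k+1..n. h i * \<alpha> i)"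
        proof (rule sum.cong)
          fix i assume "i \<in> {k+1..n}"
          with anti[of "k + 1" i] True have "\<alpha> i \<le> \<beta>" by simp
          then show "h i * ?a i = h i * \<alpha> i" by simp
        qed simp
        have "(\<Sum>i=1..n. h i * ?a i) = (\<Sum>i=1..k. h i * ?a i) + (\<Sum>i=k+1..n. h i * ?a i)"
          using kn sum.ub_add_nat[of 1 k "\<lambda>i. h i * ?a i" "n - k"] by simp
        then have "(\<Sum>i=1..k. h i * ?a i) = expectation S - (\<Sum>i=k+1..n. h i * \<alpha> i)"
          using \<beta> tail by simp
        also have "\<dots> \<le> expectation S - stop_loss M S (Hsum h k)"
          using sl[OF kn] by simp
        also have "\<dots> = expectation (\<lambda>\<omega>. S \<omega> - max (S \<omega> - Hsum h k) 0)"
          unfolding stop_loss_eq_expectation[OF S]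
          using intS by (subst Bochner_Integration.integral_diff) (auto intro!: integrable_max)
        also have "(\<lambda>\<omega>. S \<omega> - max (S \<omega> - Hsum h k) 0) = (\<lambda>\<omega>. min (S \<omega>) (Hsum h k))"
          by (auto simp: min_def max_def)
        finally show ?thesis .
      next
        \<comment> \<open>The cap is active up to \<open>k + 1\<close>, so the prefix sums at
          \<open>k\<close> and \<open>k + 1\<close> are \<open>\<beta>\<close> times
          \<open>Hsum\<close>. Scaling the inequality at \<open>k + 1\<close> by the ratio
          \<open>?r\<close> gives the one at \<open>k\<close>.\<close>
        case False
        have const: "(\<Sum>i=1..m. h i * ?a i) = \<beta> * Hsum h m" if "m \<le> k + 1" for m
        proof -
          have "(\<Sum>i=1..m. h i * ?a i) = (\<Sum>i=1..m. \<beta> * h i)"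
          proof (rule sum.cong)
            fix i assume "i \<in> {1..m}"
            with anti[of i "k + 1"] that kn False have "\<beta> \<le> \<alpha> i" by simp
            then show "h i * ?a i = \<beta> * h i" by simp
          qed simp
          then show ?thesis by (simp add: Hsum_def sum_distrib_left)
        qed
        have pos: "Hsum h k > 0"
          unfolding Hsum_def using kn h(1) by (intro sum_pos) auto
        have le: "Hsum h k \<le> Hsum h (k + 1)"
          using h(1)[of "k + 1"] kn by (simp add: Hsum_def)
        let ?r = "Hsum h k / Hsum h (k + 1)"
        have "\<beta> * Hsum h (k + 1) \<le> ?\<phi> (k + 1)"
          using step.IH kn const[of "k + 1"] by simp
        then have "?r * (\<beta> * Hsum h (k + 1)) \<le> ?r * ?\<phi> (k + 1)"
          using pos le by (intro mult_left_mono) auto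
        then have "\<beta> * Hsum h k \<le> ?r * ?\<phi> (k + 1)"
          using pos le by (simp add: mult.commute)
        also have "\<dots> = expectation (\<lambda>\<omega>. ?r * min (S \<omega>) (Hsum h (k + 1)))"
          by simp
        also have "\<dots> \<le> ?\<phi> k"
        proof (rule integral_mono_AE)
          show "AE \<omega> in M. ?r * min (S \<omega>) (Hsum h (k + 1)) \<le> min (S \<omega>) (Hsum h k)"
            using S(2)
          proof eventually_elim
            case (elim \<omega>)
            have r: "0 \<le> ?r" "?r \<le> 1" using pos le by auto
            \<comment> \<open>The right-hand side is \<open>Hsum h k\<close>. The bound by
              \<open>S \<omega>\<close> that follows rests on \<open>?r \<le> 1\<close> and
              \<open>S \<omega> \<ge> 0\<close>.\<close>
            have "?r * min (S \<omega>) (Hsum h (k + 1)) \<le> ?r * Hsum h (k + 1)"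
              using r(1) by (intro mult_left_mono) auto
            moreover have "?r * min (S \<omega>) (Hsum h (k + 1)) \<le> 1 * S \<omega>"
              using r elim pos le by (intro mult_mono) auto
            ultimately show ?case using pos le by simp
          qed
        qed (use intT in auto)
        finally show ?thesis using const[of k] by simp
      qed
    qed
  qed
  obtain b where b: "decomposable M n h b S"
    "\<And>k. k \<le> n \<Longrightarrow> (\<Sum>i=1..k. h i * b i) = ?\<phi> k"
    using decomposable_greedy[OF h S] by blast
  show ?thesis
  proof (rule decomposable_majorized[OF h(1) _ b(1)])
    show "?a j \<le> ?a i" if "1 \<le> i" "i < j" "j \<le> n" for i j
      using anti[of i j] that by (simp add: min_le_iff_disj)
  qed (use prefix total b(2) in auto)
qed

theorem theorem2:
  fixes M :: "'a measure" and S :: "'a \<Rightarrow> real"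
    and n :: nat and h \<alpha> :: "nat \<Rightarrow> real"
  assumes "n \<ge> 2"
    and "\<forall>k\<in>{1..n}. h k > 0"
    and "(\<Sum>k=1..n. h k) = 1"
    and "1 \<ge> \<alpha> 1"
    and "\<forall>k\<in>{1..<n}. \<alpha> k > \<alpha> (k + 1)"
    and "\<alpha> n > 0"
    and "\<alpha> n \<le> 1 / 2"
    and "prob_space M"
    and "S \<in> borel_measurable M"
    and "AE \<omega> in M. S \<omega> \<in> {0..1}"
    and "integral\<^sup>L M S \<le> dotp n h \<alpha>"
  defines "claim1 \<equiv> (\<exists>a. (\<forall>k\<in>{1..n}. 0 \<le> a k \<and> a k \<le> \<alpha> k) \<and> decomposable M n h a S)"
    and "claim2 \<equiv> (\<forall>k\<in>{1..n-1}. stop_loss M S (Hsum h k) \<le> (1 - Hsum h k) * tail_avg n h \<alpha> k)"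
    and "claim3 \<equiv> (\<exists>\<beta>\<in>{0..\<alpha> 1}. dotp n h (\<lambda>k. min \<beta> (\<alpha> k)) = integral\<^sup>L M S \<and>
                        decomposable M n h (\<lambda>k. min \<beta> (\<alpha> k)) S)"
  shows "(claim1 \<longleftrightarrow> claim2) \<and> (claim2 \<longleftrightarrow> claim3)"
proof -
  interpret prob_space M by fact
  have h: "\<And>k. k \<in> {1..n} \<Longrightarrow> h k > 0" and h1: "(\<Sum>k=1..n. h k) = 1"
    using assms by auto
  note S = \<open>S \<in> borel_measurable M\<close> \<open>AE \<omega> in M. S \<omega> \<in> {0..1}\<close>
  have anti: "\<alpha> j \<le> \<alpha> i" if "1 \<le> i" "i \<le> j" "j \<le> n" for i j
    using that(2,1,3)
  proof (induction j rule: dec_induct)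
    case (step j)
    then have "\<alpha> (j + 1) < \<alpha> j" using assms(5) by simp
    with step show ?case by simp
  qed simp
  have \<alpha>0: "0 \<le> \<alpha> k" if "k \<in> {1..n}" for k
    using anti[of k n] that \<open>\<alpha> n > 0\<close> by simp
  \<comment> \<open>The denominator of \<open>tail_avg\<close> is the weight left after
    \<open>k\<close>, positive because \<open>k < n\<close>, so it cancels.\<close>
  have tail: "(1 - Hsum h k) * tail_avg n h \<alpha> k = (\<Sum>i=k+1..n. h i * \<alpha> i)"
    if "k \<in> {1..n-1}" for k
  proof -
    have kn: "k \<le> n" using that by auto
    have "(\<Sum>i=1..n. h i) = Hsum h k + (\<Sum>i=k+1..n. h i)"
      using kn sum.ub_add_nat[of 1 k h "n - k"] by (simp add: Hsum_def)
    moreover have "(\<Sum>i=k+1..n. h i) > 0"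
      using that h by (intro sum_pos) auto
    ultimately have "1 - Hsum h k \<noteq> 0" using h1 by simp
    then show ?thesis by (simp add: tail_avg_def)
  qed
  have "claim2" if "claim1"
  proof -
    obtain a where a: "\<forall>k\<in>{1..n}. 0 \<le> a k \<and> a k \<le> \<alpha> k" "decomposable M n h a S"
      using \<open>claim1\<close> unfolding claim1_def by blast
    show ?thesis
      unfolding claim2_def
    proof
      fix k assume k: "k \<in> {1..n-1}"
      then have "stop_loss M S (Hsum h k) \<le> (\<Sum>i=k+1..n. h i * a i)"
        by (intro stop_loss_le_of_decomposable h S a) auto
      also have "\<dots> \<le> (\<Sum>i=k+1..n. h i * \<alpha> i)"
        using a(1) h by (intro sum_mono mult_left_mono) (auto intro: less_imp_le)
      finally show "stop_loss M S (Hsum h k) \<le> (1 - Hsum h k) * tail_avg n h \<alpha> k"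
        using tail[OF k] by simp
    qed
  qed
  moreover have "claim3" if "claim2"
  proof -
    \<comment> \<open>The cap \<open>\<beta>\<close> comes from the intermediate value theorem:
      \<open>?g\<close> is continuous, vanishes at 0 and reaches \<open>dotp n h \<alpha>\<close>,
      an upper bound for the mean of \<open>S\<close>, at \<open>\<alpha> 1\<close>.\<close>
    let ?g = "\<lambda>\<beta>. dotp n h (\<lambda>k. min \<beta> (\<alpha> k))"
    have "?g 0 = 0"
      using \<alpha>0 by (simp add: dotp_def)
    moreover have "?g (\<alpha> 1) = dotp n h \<alpha>"
      unfolding dotp_def
    proof (rule sum.cong)
      fix k assume "k \<in> {1..n}"
      with anti[of 1 k] show "h k * min (\<alpha> 1) (\<alpha> k) = h k * \<alpha> k" by simp
    qed simp
    moreover have "0 \<le> expectation S"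
      using S(2) by (intro integral_nonneg_AE) (auto elim: eventually_mono)
    moreover have "continuous_on {0..\<alpha> 1} ?g"
      unfolding dotp_def by (intro continuous_intros)
    ultimately obtain \<beta> where \<beta>: "0 \<le> \<beta>" "\<beta> \<le> \<alpha> 1" "?g \<beta> = expectation S"
      using IVT'[of ?g 0 "expectation S" "\<alpha> 1"] \<alpha>0[of 1] assms(1,11) by auto
    have "decomposable M n h (\<lambda>k. min \<beta> (\<alpha> k)) S"
    proof (rule decomposable_min_of_stop_loss_le[OF h h1 anti S])
      fix k assume "k \<in> {1..<n}"
      then have k: "k \<in> {1..n-1}" by auto
      then show "stop_loss M S (Hsum h k) \<le> (\<Sum>i=k+1..n. h i * \<alpha> i)"
        using \<open>claim2\<close> tail[OF k] unfolding claim2_def by metis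
    qed (use \<beta>(3) in \<open>auto simp: dotp_def\<close>)
    with \<beta> show ?thesis unfolding claim3_def by auto
  qed
  moreover have "claim1" if "claim3"
  proof -
    obtain \<beta> where "0 \<le> \<beta>" "decomposable M n h (\<lambda>k. min \<beta> (\<alpha> k)) S"
      using \<open>claim3\<close> unfolding claim3_def by auto
    then show ?thesis
      unfolding claim1_def using \<alpha>0 by (intro exI[of _ "\<lambda>k. min \<beta> (\<alpha> k)"]) simp
  qed
  ultimately show ?thesis by blast
qed

end
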